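(* Fix an attack $\psi=[\mathrm{sp}^{\rm a},\delta]\in\Psi$ and load-control parameters $\gamma\in\Gamma$, and let $\widehat{\mathrm{sp}}^{\rm d\star}$ be the optimal defender set-points of the problem of minimizing $\widehat{\mathrm L}(\widehat{\mathrm x}(\psi,[\mathrm{sp}^{\rm d},\gamma]))$ over $\mathrm{sp}^{\rm d}\in\mathcal S$ (subject to $\widehat{\mathrm x}\in\widehat{\mathcal X}$). Then for all $i\in\mathcal N$, $$\delta_i=0\ \Longrightarrow\ |\widehat{\mathrm{sp}}^{\rm d\star}_i|=\overline{\mathrm{sp}}_i,\qquad \angle\,\widehat{\mathrm{sp}}^{\rm d\star}_i\in[\operatorname{arccot}\overline K,\ \operatorname{arccot}\underline K].$$ Furthermore, if $r_j/x_j=K$ is the same for all lines, then for all $i\in\mathcal N$, $$\delta_i=0\ \Longrightarrow\ |\widehat{\mathrm{sp}}^{\rm d\star}_i|=\overline{\mathrm{sp}}_i,\qquad \angle\,\widehat{\mathrm{sp}}^{\rm d\star}_i=\operatorname{arccot}K.$$ Similar results hold for the $\epsilon$-LPF problem of minimizing $\check{\mathrm L}(\check{\mathrm x}(\psi,[\mathrm{sp}^{\rm d},\gamma]))$ over $\mathrm{sp}^{\rm d}\in\mathcal S$ subject to $\check{\mathrm x}\in\check{\mathcal X}$.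
   Context: Conventions. $\mathbf j=\sqrt{-1}$; a bar over $z_j$ or $Z_{ij}$ is complex conjugation; $\angle p$ is the argument of $p\in\mathbb C$; $\operatorname{arccot}$ of a positive number lies in $(0,\pi/2)$; inequalities between complex numbers or vectors are componentwise (real and imaginary parts separately); $\odot$ is the entrywise product; $(t)_+=\max(t,0)$. Network. $(\mathcal N\cup\{0\},\mathcal E)$ is a finite tree rooted at the substation node $0$, $N=|\mathcal N|$; a line $(i,j)\in\mathcal E$ goes from parent $i$ to child $j$, and its quantities are indexed by $j$. Its impedance is $z_j=r_j+\mathbf j x_j$ with $r_j,x_j>0$; $K_j=r_j/x_j$, and $\underline K,\overline K$ are the minimum and maximum of the $K_j$ over all lines. $\mathcal P_i$ is the set of nodes on the path from $0$ to $i$, including $i$ and excluding $0$. $Z_{ij}=\sum_{k\in\mathcal P_i\cap\mathcal P_j}z_k=R_{ij}+\mathbf jX_{ij}$. $H$ is the height of the tree. Fixed data: the squared substation voltage $\nu_0$; nominal demands $\mathrm{sc}^{\rm nom}_i=\mathrm{pc}^{\rm nom}_i+\mathbf j\,\mathrm{qc}^{\rm nom}_i$; DER (distributed energy resource) capabilities $\overline{\mathrm{sp}}_i$; soft voltage bounds $\underline\nu_i\le\overline\nu_i$; hard bounds $0<\underline\mu<\min_i\underline\nu_i\le\max_i\overline\nu_i<\overline\mu$; weights $W,C\in\mathbb R_+^{N}$; load-control limits $\underline\gamma_i\ge0$. Let $\mathcal S_i=\{p\in\mathbb C:\mathrm{Re}(p)\ge0,\ |p|\le\overline{\mathrm{sp}}_i\}$,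 $\mathcal S=\prod_i\mathcal S_i$, $\Gamma=\prod_i[\underline\gamma_i,1]$. Strategies (no DER is secured). The attacker picks $\psi=[\mathrm{sp}^{\rm a},\delta]\in\Psi=\mathcal S\times\mathcal D_M$, where $\mathcal D_M=\{\delta\in\{0,1\}^{\mathcal N}:\|\delta\|_0\le M\}$ with $M\le N$ fixed. The defender picks $\phi=[\mathrm{sp}^{\rm d},\gamma]\in\Phi=\mathcal S\times\Gamma$. They determine consumption and generation $sc_i=\gamma_i\,\mathrm{sc}^{\rm nom}_i$, $sg_i=\delta_i\mathrm{sp}^{\rm a}_i+(1-\delta_i)\mathrm{sp}^{\rm d}_i$. Power flow models. A state is $\mathrm x=[\nu,\ell,sc,sg,S]\in\mathbb R_+^{2N}\times\mathbb C^{3N}$. For all $(i,j)\in\mathcal E$: NPF: $S_j=\sum_{k:(j,k)\in\mathcal E}S_k+sc_j-sg_j+z_j\ell_j$, $\nu_j=\nu_i-2\mathrm{Re}(\bar z_jS_j)+|z_j|^2\ell_j$, $\ell_j=|S_j|^2/\nu_i$. LPF: $\widehat S_j=\sum_{k:(j,k)\in\mathcal E}\widehat S_k+sc_j-sg_j$, $\widehat\nu_j=\widehat\nu_i-2\mathrm{Re}(\bar z_j\widehat S_j)$, $\widehat\ell_j=|\widehat S_j|^2/\widehat\nu_i$. $\epsilon$-LPF: $\check S_j=\sum_{k:(j,k)\in\mathcal E}\check S_k+(1+\epsilon)(sc_j-sg_j)$, $\check\nu_j=\check\nu_i-2\mathrm{Re}(\bar z_j\check S_j)$, $\check\ell_j=|\check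 S_j|^2/\check\nu_i$, where $\epsilon=(1-\epsilon_0)^{-H}-1$. (The substation's squared voltage is $\nu_0$ in all models.) $\mathcal X,\widehat{\mathcal X},\check{\mathcal X}$ are the sets of states of the respective models satisfying the hard bounds $\underline\mu\le\nu_i\le\overline\mu$, $sc\le\mathrm{sc}^{\rm nom}$, $sg_i\le \mathrm{sp}_i$ for set-points $\mathrm{sp}_i\in\mathcal S_i$, and no reverse flow $S\ge0$. $\widehat{\mathrm x}(\psi,\phi),\check{\mathrm x}(\psi,\phi)$ denote the LPF and $\epsilon$-LPF states with the $sc,sg$ determined by $(\psi,\phi)$. Losses. $\mathrm L_{VR}(\mathrm x)=\|W\odot(\underline\nu-\nu)_+\|_\infty$, $\mathrm L_{LC}(\mathrm x)=\|C\odot(1-\gamma)\odot\mathrm{pc}^{\rm nom}\|_1$; $\widehat{\mathrm L}(\widehat{\mathrm x})=\mathrm L_{VR}(\widehat{\mathrm x})+\mathrm L_{LC}(\widehat{\mathrm x})$, $\check{\mathrm L}(\check{\mathrm x})=\mathrm L_{VR}(\check{\mathrm x})+\mathrm L_{LC}(\check{\mathrm x})$. Standing assumptions (A0). (i) Without attack the states in $\mathcal X$ and $\widehat{\mathcal X}$ satisfy $\underline\nu_i\le\nu_i\le\overline\nu_i$. (ii) The hard voltage bounds hold for all strategy profiles. (iii) There are no reverse power flows: all power flows are $\ge0$ (hence all squared nodal voltages are $\le\nu_0$). (iv) $\nu_0=1$, $|S_j|<1$ for all lines, $r_j\le\frac{\underline\mu^2}{4\underline\mu+8}<1$, $x_j\le\frac{\underline\mu^2}{4\underline\mu+8}<1$,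 and $R_{ii}\le1$, $X_{ii}\le1$ for all $i$. (v) $z\odot\ell\le\epsilon_0S$ for every $\mathrm x\in\mathcal X$, where $\epsilon_0$ is a small positive number.
   Formalization: Optima need not be unique: the claim is proved for some optimum at all i with δ_i=0, and for every optimum at those i where L_VR>0 and i shares a line with every node of worst weighted violation; no angle is claimed if the DER capability of i is 0; the problem is assumed feasible. *)

theory Defs
  imports "HOL-Analysis.Analysis"
begin

definition rooted_tree :: "'a \<Rightarrow> ('a \<times> 'a) set \<Rightarrow> bool" where
  "rooted_tree r E \<longleftrightarrow>
     (\<forall>i. (i, r) \<notin> E) \<and> (\<forall>j. j \<noteq> r \<longrightarrow> (\<exists>!i. (i, j) \<in> E)) \<and> (\<forall>j. (r, j) \<in> E\<^sup>*)"

definition arccot :: "real \<Rightarrow> real" where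
  "arccot t = (THE \<theta>. 0 < \<theta> \<and> \<theta> < pi \<and> cot \<theta> = t)"

text \<open>Componentwise order on complex numbers; this is not the order of the library's
  \<open>Complex_Order\<close>, which requires equal imaginary parts.\<close>

definition cle :: "complex \<Rightarrow> complex \<Rightarrow> bool" where
  "cle a b \<longleftrightarrow> Re a \<le> Re b \<and> Im a \<le> Im b"

text \<open>The type \<^typ>\<open>'n\<close> is the set of nodes other than the substation. The substation is
  \<^term>\<open>None\<close>, and the line \<open>(i, Some j)\<close> is indexed by \<open>j\<close>.\<close>

record ('n::finite) network =
  lines :: "('n option \<times> 'n option) set"
  imped :: "complex ^ 'n"
  nu_sub :: real
  sc_nom :: "complex ^ 'n"
  sp_cap :: "real ^ 'n"
  nu_lo :: "real ^ 'n"
  nu_hi :: "real ^ 'n"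
  mu_lo :: real
  mu_hi :: real
  wVR :: "real ^ 'n"
  wLC :: "real ^ 'n"
  gam_lo :: "real ^ 'n"
  eps0 :: real

record ('n::finite) state =
  nu :: "real ^ 'n"
  ell :: "real ^ 'n"
  sc :: "complex ^ 'n"
  sg :: "complex ^ 'n"
  flow :: "complex ^ 'n"

text \<open>An attack is a pair \<open>(sp\<^sup>a, \<delta>)\<close> and a defense a pair \<open>(sp\<^sup>d, \<gamma>)\<close>.\<close>

type_synonym 'n strategy = "(complex ^ 'n) \<times> (real ^ 'n)"


definition network_data :: "('n::finite) network \<Rightarrow> bool" where
  "network_data G \<longleftrightarrow>
     rooted_tree None (lines G) \<and>
     (\<forall>j. 0 < Re (imped G $ j) \<and> 0 < Im (imped G $ j)) \<and>
     (\<forall>i. 0 \<le> sp_cap G $ i) \<and>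
     (\<forall>i. nu_lo G $ i \<le> nu_hi G $ i) \<and>
     0 < mu_lo G \<and> (\<forall>i. mu_lo G < nu_lo G $ i) \<and> (\<forall>i. nu_hi G $ i < mu_hi G) \<and>
     (\<forall>i. 0 \<le> wVR G $ i) \<and> (\<forall>i. 0 \<le> wLC G $ i) \<and>
     (\<forall>i. 0 \<le> gam_lo G $ i)"

definition ratio :: "('n::finite) network \<Rightarrow> 'n \<Rightarrow> real" where
  "ratio G j = Re (imped G $ j) / Im (imped G $ j)"

definition K_min :: "('n::finite) network \<Rightarrow> real" where
  "K_min G = Min (range (ratio G))"

definition K_max :: "('n::finite) network \<Rightarrow> real" where
  "K_max G = Max (range (ratio G))"

text \<open>In a tree, the nodes on the path from the root to \<open>i\<close> are the ancestors of \<open>i\<close>,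
  with \<open>i\<close> itself; the root is excluded since it is not of the form \<open>Some j\<close>.\<close>

definition path_nodes :: "('n::finite) network \<Rightarrow> 'n \<Rightarrow> 'n set" where
  "path_nodes G i = {j. (Some j, Some i) \<in> (lines G)\<^sup>*}"

definition Zpath :: "('n::finite) network \<Rightarrow> 'n \<Rightarrow> 'n \<Rightarrow> complex" where
  "Zpath G i j = (\<Sum>k \<in> path_nodes G i \<inter> path_nodes G j. imped G $ k)"

definition height :: "('n::finite) network \<Rightarrow> nat" where
  "height G = Max (range (\<lambda>i. card (path_nodes G i)))"

definition eps :: "('n::finite) network \<Rightarrow> real" where
  "eps G = (1 - eps0 G) powi (- int (height G)) - 1"


definition setpoints :: "('n::finite) network \<Rightarrow> (complex ^ 'n) set" where
  "setpoints G = {sp. \<forall>i. 0 \<le> Re (sp $ i) \<and> cmod (sp $ i) \<le> sp_cap G $ i}"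

definition load_controls :: "('n::finite) network \<Rightarrow> (real ^ 'n) set" where
  "load_controls G = {\<gamma>. \<forall>i. \<gamma> $ i \<in> {gam_lo G $ i .. 1}}"

definition attacks :: "('n::finite) network \<Rightarrow> nat \<Rightarrow> 'n strategy set" where
  "attacks G M =
     setpoints G \<times> {\<delta>. (\<forall>i. \<delta> $ i \<in> {0, 1}) \<and> card {i. \<delta> $ i \<noteq> 0} \<le> M}"

definition defenses :: "('n::finite) network \<Rightarrow> 'n strategy set" where
  "defenses G = setpoints G \<times> load_controls G"

definition consumption :: "('n::finite) network \<Rightarrow> 'n strategy \<Rightarrow> complex ^ 'n" where
  "consumption G \<phi> = (\<chi> i. snd \<phi> $ i *\<^sub>R sc_nom G $ i)"

definition generation :: "('n::finite) strategy \<Rightarrow> 'n strategy \<Rightarrow> complex ^ 'n" where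
  "generation \<psi> \<phi> =
     (\<chi> i. snd \<psi> $ i *\<^sub>R fst \<psi> $ i + (1 - snd \<psi> $ i) *\<^sub>R fst \<phi> $ i)"


definition volt :: "('n::finite) network \<Rightarrow> 'n state \<Rightarrow> 'n option \<Rightarrow> real" where
  "volt G x i = (case i of None \<Rightarrow> nu_sub G | Some k \<Rightarrow> nu x $ k)"

definition npf :: "('n::finite) network \<Rightarrow> 'n state \<Rightarrow> bool" where
  "npf G x \<longleftrightarrow> (\<forall>i j. (i, Some j) \<in> lines G \<longrightarrow>
     flow x $ j = (\<Sum>k | (Some j, Some k) \<in> lines G. flow x $ k) + sc x $ j - sg x $ j
                  + imped G $ j * of_real (ell x $ j) \<and>
     nu x $ j = volt G x i - 2 * Re (cnj (imped G $ j) * flow x $ j)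
                  + (cmod (imped G $ j))\<^sup>2 * ell x $ j \<and>
     ell x $ j = (cmod (flow x $ j))\<^sup>2 / volt G x i)"

definition lpf :: "('n::finite) network \<Rightarrow> 'n state \<Rightarrow> bool" where
  "lpf G x \<longleftrightarrow> (\<forall>i j. (i, Some j) \<in> lines G \<longrightarrow>
     flow x $ j = (\<Sum>k | (Some j, Some k) \<in> lines G. flow x $ k) + sc x $ j - sg x $ j \<and>
     nu x $ j = volt G x i - 2 * Re (cnj (imped G $ j) * flow x $ j) \<and>
     ell x $ j = (cmod (flow x $ j))\<^sup>2 / volt G x i)"

definition elpf :: "('n::finite) network \<Rightarrow> 'n state \<Rightarrow> bool" where
  "elpf G x \<longleftrightarrow> (\<forall>i j. (i, Some j) \<in> lines G \<longrightarrow>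
     flow x $ j = (\<Sum>k | (Some j, Some k) \<in> lines G. flow x $ k)
                  + (1 + eps G) *\<^sub>R (sc x $ j - sg x $ j) \<and>
     nu x $ j = volt G x i - 2 * Re (cnj (imped G $ j) * flow x $ j) \<and>
     ell x $ j = (cmod (flow x $ j))\<^sup>2 / volt G x i)"

definition hard_bounds :: "('n::finite) network \<Rightarrow> 'n state \<Rightarrow> bool" where
  "hard_bounds G x \<longleftrightarrow> (\<forall>i. mu_lo G \<le> nu x $ i \<and> nu x $ i \<le> mu_hi G)"

definition soft_bounds :: "('n::finite) network \<Rightarrow> 'n state \<Rightarrow> bool" where
  "soft_bounds G x \<longleftrightarrow> (\<forall>i. nu_lo G $ i \<le> nu x $ i \<and> nu x $ i \<le> nu_hi G $ i)"

definition no_reverse_flow :: "('n::finite) state \<Rightarrow> bool" where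
  "no_reverse_flow x \<longleftrightarrow> (\<forall>j. cle 0 (flow x $ j))"

definition admissible :: "('n::finite) network \<Rightarrow> 'n state \<Rightarrow> bool" where
  "admissible G x \<longleftrightarrow>
     (\<forall>i. 0 \<le> nu x $ i \<and> 0 \<le> ell x $ i) \<and>
     hard_bounds G x \<and>
     (\<forall>i. cle (sc x $ i) (sc_nom G $ i)) \<and>
     (\<exists>sp \<in> setpoints G. \<forall>i. cle (sg x $ i) (sp $ i)) \<and>
     no_reverse_flow x"

definition X_npf :: "('n::finite) network \<Rightarrow> 'n state set" where
  "X_npf G = {x. npf G x \<and> admissible G x}"

definition X_lpf :: "('n::finite) network \<Rightarrow> 'n state set" where
  "X_lpf G = {x. lpf G x \<and> admissible G x}"

definition X_elpf :: "('n::finite) network \<Rightarrow> 'n state set" where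
  "X_elpf G = {x. elpf G x \<and> admissible G x}"

text \<open>The linear models determine the state uniquely. The nonlinear equations may have further,
  low-voltage solutions, so there the strategies only determine a set of states.\<close>

definition npf_states ::
  "('n::finite) network \<Rightarrow> 'n strategy \<Rightarrow> 'n strategy \<Rightarrow> 'n state set" where
  "npf_states G \<psi> \<phi> = {x. npf G x \<and> sc x = consumption G \<phi> \<and> sg x = generation \<psi> \<phi>}"

definition lpf_state ::
  "('n::finite) network \<Rightarrow> 'n strategy \<Rightarrow> 'n strategy \<Rightarrow> 'n state" where
  "lpf_state G \<psi> \<phi> = (THE x. lpf G x \<and> sc x = consumption G \<phi> \<and> sg x = generation \<psi> \<phi>)"

definition elpf_state ::
  "('n::finite) network \<Rightarrow> 'n strategy \<Rightarrow> 'n strategy \<Rightarrow> 'n state" where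
  "elpf_state G \<psi> \<phi> = (THE x. elpf G x \<and> sc x = consumption G \<phi> \<and> sg x = generation \<psi> \<phi>)"


definition weighted_violation :: "('n::finite) network \<Rightarrow> 'n state \<Rightarrow> real ^ 'n" where
  "weighted_violation G x = (\<chi> i. wVR G $ i * max (nu_lo G $ i - nu x $ i) 0)"

definition loss_VR :: "('n::finite) network \<Rightarrow> 'n state \<Rightarrow> real" where
  "loss_VR G x = infnorm (weighted_violation G x)"

definition loss_LC :: "('n::finite) network \<Rightarrow> real ^ 'n \<Rightarrow> real" where
  "loss_LC G \<gamma> = (\<Sum>i\<in>UNIV. \<bar>wLC G $ i * (1 - \<gamma> $ i) * Re (sc_nom G $ i)\<bar>)"

definition loss :: "('n::finite) network \<Rightarrow> real ^ 'n \<Rightarrow> 'n state \<Rightarrow> real" where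
  "loss G \<gamma> x = loss_VR G x + loss_LC G \<gamma>"


text \<open>The state assumptions are imposed on the states that arise from strategy profiles, because
  the sets \<open>X\<close> bound \<open>sc\<close> and \<open>sg\<close> from above only. In \<open>voltage_quality\<close> the soft bounds are
  required for some defense: if they held for every defense, they would also hold under every
  attack, since an attacked generator produces a set-point that is available to the defender.\<close>

definition voltage_quality :: "('n::finite) network \<Rightarrow> bool" where
  "voltage_quality G \<longleftrightarrow> (\<exists>\<phi> \<in> defenses G. \<forall>\<psi> \<in> attacks G 0.
     (\<forall>x \<in> npf_states G \<psi> \<phi> \<inter> X_npf G. soft_bounds G x) \<and>
     (lpf_state G \<psi> \<phi> \<in> X_lpf G \<longrightarrow> soft_bounds G (lpf_state G \<psi> \<phi>)))"

definition safe_profiles :: "('n::finite) network \<Rightarrow> nat \<Rightarrow> bool" where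
  "safe_profiles G M \<longleftrightarrow> (\<forall>\<psi> \<in> attacks G M. \<forall>\<phi> \<in> defenses G.
     (\<exists>x \<in> npf_states G \<psi> \<phi>. hard_bounds G x \<and> no_reverse_flow x) \<and>
     hard_bounds G (lpf_state G \<psi> \<phi>) \<and> no_reverse_flow (lpf_state G \<psi> \<phi>) \<and>
     hard_bounds G (elpf_state G \<psi> \<phi>) \<and> no_reverse_flow (elpf_state G \<psi> \<phi>))"

definition small_impedance :: "('n::finite) network \<Rightarrow> nat \<Rightarrow> bool" where
  "small_impedance G M \<longleftrightarrow>
     nu_sub G = 1 \<and>
     (\<forall>\<psi> \<in> attacks G M. \<forall>\<phi> \<in> defenses G.
        \<forall>x \<in> (npf_states G \<psi> \<phi> \<inter> X_npf G) \<union> ({lpf_state G \<psi> \<phi>} \<inter> X_lpf G)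
              \<union> ({elpf_state G \<psi> \<phi>} \<inter> X_elpf G).
          \<forall>j. cmod (flow x $ j) < 1) \<and>
     (\<forall>j. Re (imped G $ j) \<le> (mu_lo G)\<^sup>2 / (4 * mu_lo G + 8)) \<and>
     (\<forall>j. Im (imped G $ j) \<le> (mu_lo G)\<^sup>2 / (4 * mu_lo G + 8)) \<and>
     (mu_lo G)\<^sup>2 / (4 * mu_lo G + 8) < 1 \<and>
     (\<forall>i. Re (Zpath G i i) \<le> 1 \<and> Im (Zpath G i i) \<le> 1)"

definition small_losses :: "('n::finite) network \<Rightarrow> nat \<Rightarrow> bool" where
  "small_losses G M \<longleftrightarrow>
     0 < eps0 G \<and> eps0 G < 1 \<and>
     (\<forall>\<psi> \<in> attacks G M. \<forall>\<phi> \<in> defenses G. \<forall>x \<in> npf_states G \<psi> \<phi> \<inter> X_npf G. \<forall>j.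
        cle (imped G $ j * of_real (ell x $ j)) (of_real (eps0 G) * flow x $ j))"

definition standing_assumptions :: "('n::finite) network \<Rightarrow> nat \<Rightarrow> bool" where
  "standing_assumptions G M \<longleftrightarrow>
     voltage_quality G \<and> safe_profiles G M \<and> small_impedance G M \<and> small_losses G M"


definition feasible_setpoints ::
  "('n::finite) network \<Rightarrow> 'n state set \<Rightarrow> ('n strategy \<Rightarrow> 'n state) \<Rightarrow> real ^ 'n
    \<Rightarrow> (complex ^ 'n) set" where
  "feasible_setpoints G X st \<gamma> = {sp \<in> setpoints G. st (sp, \<gamma>) \<in> X}"

definition optimal_setpoints ::
  "('n::finite) network \<Rightarrow> 'n state set \<Rightarrow> ('n strategy \<Rightarrow> 'n state) \<Rightarrow> real ^ 'n
    \<Rightarrow> (complex ^ 'n) set" where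
  "optimal_setpoints G X st \<gamma> =
     {sp. is_arg_min (\<lambda>sp. loss G \<gamma> (st (sp, \<gamma>))) (\<lambda>sp. sp \<in> feasible_setpoints G X st \<gamma>) sp}"

text \<open>The number \<open>0\<close> has no argument (the library sets \<^term>\<open>Arg 0 = 0\<close>), so nothing is required
  of the argument of the set-point of a node without generation capability.\<close>

definition full_output_at :: "('n::finite) network \<Rightarrow> complex ^ 'n \<Rightarrow> 'n \<Rightarrow> real set \<Rightarrow> bool" where
  "full_output_at G sp i A \<longleftrightarrow>
     cmod (sp $ i) = sp_cap G $ i \<and> (sp_cap G $ i \<noteq> 0 \<longrightarrow> Arg (sp $ i) \<in> A)"

text \<open>Only voltage regulation depends on the set-points, and generation at \<open>i\<close> does not affect the
  voltage at \<open>k\<close> if the paths to \<open>i\<close> and \<open>k\<close> share no line. The next definition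
  says that the set-point of node \<open>i\<close> matters for the loss: there is a violation, and
  generation at \<open>i\<close> affects the voltage at all nodes where the violation is worst.\<close>

definition affects_loss :: "('n::finite) network \<Rightarrow> 'n state \<Rightarrow> 'n \<Rightarrow> bool" where
  "affects_loss G x i \<longleftrightarrow>
     0 < loss_VR G x \<and>
     (\<forall>k. weighted_violation G x $ k = loss_VR G x \<longrightarrow> path_nodes G i \<inter> path_nodes G k \<noteq> {})"

end

theory Submission
  imports Defs
begin

text \<open>In both linear models the squared voltage at \<open>k\<close> is an affine function of the set-points,
  in which the set-point \<open>sp\<^sub>i\<close> of an unattacked node \<open>i\<close> enters through a positive multiple of \<open>Re (cnj Z\<^sub>k\<^sub>i * sp\<^sub>i)\<close>. Each nonzero \<open>Z\<^sub>k\<^sub>i\<close> is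
  a sum of line impedances, so its argument lies between \<open>arccot\<close> of the largest and of the smallest
  ratio \<open>r/x\<close>. Clamping the argument of \<open>sp\<^sub>i\<close> to this interval and raising its modulus to the cap
  therefore lowers no voltage, and strictly raises every voltage with \<open>Z\<^sub>k\<^sub>i \<noteq> 0\<close> unless \<open>sp\<^sub>i\<close> already
  had this form. Applied to every node it turns any minimizer into one of the required form; applied
  to a single node that affects all worst violations it would decrease the loss.\<close>

section \<open>Rooted trees: paths, parents and subtrees\<close>

locale radial_network =
  fixes G :: "('n::finite) network"
  assumes tree: "rooted_tree None (lines G)"
begin

lemma no_line_into_root: "(i, None) \<notin> lines G"
  using tree by (simp add: rooted_tree_def)

lemma parent_ex: "\<exists>i. (i, Some j) \<in> lines G"
  using tree unfolding rooted_tree_def by blast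

lemma parent_unique: "(i, Some j) \<in> lines G \<Longrightarrow> (i', Some j) \<in> lines G \<Longrightarrow> i = i'"
  using tree unfolding rooted_tree_def by blast

lemma root_reaches: "(None, j) \<in> (lines G)\<^sup>*"
  using tree by (simp add: rooted_tree_def)

text \<open>A cycle through a node enters it from its unique parent, so the parent lies on a cycle
  as well; moving up ends at the root, which no line enters.\<close>

lemma not_on_cycle: "(j, j) \<notin> (lines G)\<^sup>+"
  using root_reaches[of j]
proof (induction rule: rtrancl_induct)
  case base
  show ?case
    using no_line_into_root by (meson tranclD2)
next
  case (step i j)
  show ?case
  proof
    assume "(j, j) \<in> (lines G)\<^sup>+"
    then obtain i' where "(j, i') \<in> (lines G)\<^sup>*" "(i', j) \<in> lines G"
      by (meson tranclD2)
    moreover have "i' = i"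
      using step.hyps \<open>(i', j) \<in> lines G\<close> no_line_into_root parent_unique
      by (metis not_Some_eq)
    ultimately have "(i, i) \<in> (lines G)\<^sup>+"
      using step.hyps by (meson rtrancl_into_trancl2)
    with step.IH show False by simp
  qed
qed

lemma acyclic_lines: "acyclic (lines G)"
  using not_on_cycle by (simp add: acyclic_def)

text \<open>Provides induction from the leaves upward: in the converse relation the children of a
  node lie below it.\<close>

lemma wf_children: "wf ((lines G)\<inverse>)"
  using acyclic_lines by (simp add: finite_acyclic_wf_converse)

lemma reach_through_parent:
  assumes "(i, Some j) \<in> lines G" "(a, Some j) \<in> (lines G)\<^sup>*" "a \<noteq> Some j"
  shows "(a, i) \<in> (lines G)\<^sup>*"
  using assms parent_unique by (metis rtranclE)

lemma not_reach_parent: "(i, j) \<in> lines G \<Longrightarrow> (j, i) \<notin> (lines G)\<^sup>*"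
  using not_on_cycle by (meson rtrancl_into_trancl2)

lemma path_nodes_root_child:
  assumes "(None, Some j) \<in> lines G"
  shows "path_nodes G j = {j}"
proof -
  have "k = j" if "(Some k, Some j) \<in> (lines G)\<^sup>*" for k
  proof (rule ccontr)
    assume "k \<noteq> j"
    then have "(Some k, None) \<in> (lines G)\<^sup>*"
      using reach_through_parent[OF assms that] by simp
    then show False
      using no_line_into_root by (metis option.distinct(1) rtranclE)
  qed
  then show ?thesis by (auto simp: path_nodes_def)
qed

lemma path_nodes_child:
  assumes "(Some i, Some j) \<in> lines G"
  shows "path_nodes G j = insert j (path_nodes G i)" "j \<notin> path_nodes G i"
proof -
  show "path_nodes G j = insert j (path_nodes G i)"
    using reach_through_parent[OF assms] assms
    by (auto simp: path_nodes_def intro: rtrancl_into_rtrancl)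
  show "j \<notin> path_nodes G i"
    using not_reach_parent[OF assms] by (simp add: path_nodes_def)
qed

text \<open>The nodes fed through the line into \<open>j\<close>; without losses that line carries
  their net demand.\<close>

definition subtree :: "'n \<Rightarrow> 'n set" where
  "subtree j = {m. j \<in> path_nodes G m}"

text \<open>Parents are unique, so all ancestors of \<open>m\<close> lie on one path. The induction
  follows that path down from \<open>a\<close>: either \<open>b\<close> is its current end, or
  \<open>b\<close> already reaches the parent of that end.\<close>

lemma ancestors_chain:
  assumes "(a, m) \<in> (lines G)\<^sup>*" "(b, m) \<in> (lines G)\<^sup>*"
  shows "(a, b) \<in> (lines G)\<^sup>* \<or> (b, a) \<in> (lines G)\<^sup>*"
  using assms
proof (induction rule: rtrancl_induct)
  case base
  then show ?case by simp
next
  case (step i j)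
  show ?case
  proof (cases "b = j")
    case True
    then show ?thesis using step.hyps by (meson rtrancl_into_rtrancl)
  next
    case False
    then have "(b, i) \<in> (lines G)\<^sup>*"
      using step.hyps step.prems reach_through_parent no_line_into_root
      by (metis not_Some_eq)
    then show ?thesis by (rule step.IH)
  qed
qed

lemma siblings_unrelated:
  assumes "(a, Some k) \<in> lines G" "(a, Some l) \<in> lines G" "k \<noteq> l"
  shows "(Some k, Some l) \<notin> (lines G)\<^sup>*"
  using assms reach_through_parent not_reach_parent by (metis option.inject)

text \<open>A common descendant would make the siblings comparable, but a path from one to the other
  would run through their common parent and close a cycle.\<close>

lemma subtree_disjoint:
  assumes "(a, Some k) \<in> lines G" "(a, Some l) \<in> lines G" "k \<noteq> l"
  shows "subtree k \<inter> subtree l = {}"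
  using assms siblings_unrelated ancestors_chain
  by (fastforce simp: subtree_def path_nodes_def)

lemma subtree_decompose:
  "subtree j = insert j (\<Union>k\<in>{k. (Some j, Some k) \<in> lines G}. subtree k)"
proof -
  have "m = j \<or> (\<exists>k. (Some j, Some k) \<in> lines G \<and> (Some k, Some m) \<in> (lines G)\<^sup>*)"
    if "(Some j, Some m) \<in> (lines G)\<^sup>*" for m
    using that no_line_into_root by (metis converse_rtranclE not_Some_eq option.inject)
  then show ?thesis
    by (auto simp: subtree_def path_nodes_def intro: converse_rtrancl_into_rtrancl)
qed

text \<open>This is the lossless flow balance: subtree sums obey the recursion that determines the
  flows.\<close>

lemma sum_subtree:
  fixes f :: "'n \<Rightarrow> 'a::comm_monoid_add"
  shows "sum f (subtree j) = (\<Sum>k | (Some j, Some k) \<in> lines G. sum f (subtree k)) + f j"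
proof -
  have "j \<notin> (\<Union>k\<in>{k. (Some j, Some k) \<in> lines G}. subtree k)"
    using not_reach_parent by (auto simp: subtree_def path_nodes_def)
  moreover have "sum f (\<Union>k\<in>{k. (Some j, Some k) \<in> lines G}. subtree k)
      = (\<Sum>k | (Some j, Some k) \<in> lines G. sum f (subtree k))"
    using subtree_disjoint by (intro sum.UNION_disjoint) auto
  ultimately show ?thesis
    by (subst subtree_decompose) (simp add: add.commute)
qed

end

section \<open>The linear models with a common scale factor, and their explicit solution\<close>

definition scaled_lpf :: "real \<Rightarrow> ('n::finite) network \<Rightarrow> 'n state \<Rightarrow> bool" where
  "scaled_lpf c G x \<longleftrightarrow> (\<forall>i j. (i, Some j) \<in> lines G \<longrightarrow>
     flow x $ j = (\<Sum>k | (Some j, Some k) \<in> lines G. flow x $ k) + c *\<^sub>R (sc x $ j - sg x $ j) \<and>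
     nu x $ j = volt G x i - 2 * Re (cnj (imped G $ j) * flow x $ j) \<and>
     ell x $ j = (cmod (flow x $ j))\<^sup>2 / volt G x i)"

lemma lpf_eq_scaled: "lpf G = scaled_lpf 1 G"
  by (rule ext) (simp add: lpf_def scaled_lpf_def add_diff_eq)

lemma elpf_eq_scaled: "elpf G = scaled_lpf (1 + eps G) G"
  by (rule ext) (simp add: elpf_def scaled_lpf_def)

context radial_network
begin

definition parent :: "'n \<Rightarrow> 'n option" where
  "parent j = (THE i. (i, Some j) \<in> lines G)"

lemma parent_eq: "(i, Some j) \<in> lines G \<Longrightarrow> parent j = i"
  unfolding parent_def using parent_unique by blast

text \<open>Here \<open>d\<close> is the net demand. Unrolling the balance down to the leaves gives
  the flow as a subtree sum; unrolling the voltage drops up to the root gives \<open>lin_nu\<close>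
  as a path sum.\<close>

definition lin_flow :: "real \<Rightarrow> complex ^ 'n \<Rightarrow> complex ^ 'n" where
  "lin_flow c d = (\<chi> j. \<Sum>m\<in>subtree j. c *\<^sub>R d $ m)"

definition lin_nu :: "real \<Rightarrow> complex ^ 'n \<Rightarrow> real ^ 'n" where
  "lin_nu c d = (\<chi> k. nu_sub G - 2 * (\<Sum>j\<in>path_nodes G k. Re (cnj (imped G $ j) * lin_flow c d $ j)))"

definition lin_state :: "real \<Rightarrow> complex ^ 'n \<Rightarrow> complex ^ 'n \<Rightarrow> 'n state" where
  "lin_state c s g =
     \<lparr>nu = lin_nu c (s - g),
      ell = (\<chi> j. (cmod (lin_flow c (s - g) $ j))\<^sup>2 /
              (case parent j of None \<Rightarrow> nu_sub G | Some k \<Rightarrow> lin_nu c (s - g) $ k)),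
      sc = s, sg = g, flow = lin_flow c (s - g)\<rparr>"

lemma lin_flow_eq:
  "lin_flow c d $ j = (\<Sum>k | (Some j, Some k) \<in> lines G. lin_flow c d $ k) + c *\<^sub>R d $ j"
  unfolding lin_flow_def vec_lambda_beta by (rule sum_subtree)

lemma lin_nu_eq:
  assumes "(i, Some j) \<in> lines G"
  shows "lin_nu c d $ j = (case i of None \<Rightarrow> nu_sub G | Some k \<Rightarrow> lin_nu c d $ k)
           - 2 * Re (cnj (imped G $ j) * lin_flow c d $ j)"
proof (cases i)
  case None
  with assms show ?thesis by (simp add: lin_nu_def path_nodes_root_child)
next
  case (Some k)
  with assms have "(Some k, Some j) \<in> lines G" by simp
  from path_nodes_child[OF this] Some show ?thesis
    by (simp add: lin_nu_def algebra_simps)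
qed

lemma scaled_lpf_lin_state: "scaled_lpf c G (lin_state c s g)"
  unfolding scaled_lpf_def
proof (intro allI impI conjI)
  fix i j assume ij: "(i, Some j) \<in> lines G"
  have v: "volt G (lin_state c s g) i
      = (case i of None \<Rightarrow> nu_sub G | Some k \<Rightarrow> lin_nu c (s - g) $ k)"
    by (simp add: volt_def lin_state_def split: option.split)
  show "nu (lin_state c s g) $ j = volt G (lin_state c s g) i
      - 2 * Re (cnj (imped G $ j) * flow (lin_state c s g) $ j)"
    using lin_nu_eq[OF ij] unfolding v by (simp add: lin_state_def)
  show "ell (lin_state c s g) $ j
      = (cmod (flow (lin_state c s g) $ j))\<^sup>2 / volt G (lin_state c s g) i"
    unfolding v by (simp add: lin_state_def parent_eq[OF ij])
  show "flow (lin_state c s g) $ j = (\<Sum>k | (Some j, Some k) \<in> lines G. flow (lin_state c s g) $ k)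
      + c *\<^sub>R (sc (lin_state c s g) $ j - sg (lin_state c s g) $ j)"
    using lin_flow_eq[of c "s - g" j] by (simp add: lin_state_def)
qed

text \<open>Flows are determined from the leaves upward; voltages, in the next lemma, from the root
  downward.\<close>

lemma scaled_lpf_flow:
  assumes "scaled_lpf c G x"
  shows "flow x $ j = lin_flow c (sc x - sg x) $ j"
proof -
  \<comment> \<open>Stated on \<open>'n option\<close>, where the well-founded relation lives; at
    the substation the claim is vacuous.\<close>
  have "\<forall>j. a = Some j \<longrightarrow> flow x $ j = lin_flow c (sc x - sg x) $ j" for a
    using wf_children
  proof (induction a rule: wf_induct_rule)
    case (less a)
    show ?case
    proof (intro allI impI)
      fix j assume a: "a = Some j"
      have "flow x $ k = lin_flow c (sc x - sg x) $ k" if "(Some j, Some k) \<in> lines G" for k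
        using less[of "Some k"] that a by simp
      moreover have "flow x $ j
          = (\<Sum>k | (Some j, Some k) \<in> lines G. flow x $ k) + c *\<^sub>R (sc x $ j - sg x $ j)"
        using assms parent_ex[of j] unfolding scaled_lpf_def by blast
      ultimately show "flow x $ j = lin_flow c (sc x - sg x) $ j"
        by (simp add: lin_flow_eq[of c "sc x - sg x" j])
    qed
  qed
  then show ?thesis by blast
qed

lemma scaled_lpf_volt:
  assumes "scaled_lpf c G x"
  shows "volt G x a = (case a of None \<Rightarrow> nu_sub G | Some k \<Rightarrow> lin_nu c (sc x - sg x) $ k)"
  using root_reaches[of a]
proof (induction rule: rtrancl_induct)
  case base
  show ?case by (simp add: volt_def)
next
  case (step i j)
  from step.hyps obtain j' where j: "j = Some j'"
    using no_line_into_root by (cases j) auto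
  with step.hyps have ij: "(i, Some j') \<in> lines G" by simp
  then have "nu x $ j' = volt G x i - 2 * Re (cnj (imped G $ j') * flow x $ j')"
    using assms unfolding scaled_lpf_def by blast
  then show ?case
    by (simp add: j volt_def[of G x "Some j'"] step.IH lin_nu_eq[OF ij] scaled_lpf_flow[OF assms])
qed

lemma scaled_lpf_unique:
  assumes "scaled_lpf c G x"
  shows "x = lin_state c (sc x) (sg x)"
proof (rule state.equality)
  show "nu x = nu (lin_state c (sc x) (sg x))"
    using scaled_lpf_volt[OF assms, of "Some _"]
    by (simp add: vec_eq_iff lin_state_def volt_def)
  show "flow x = flow (lin_state c (sc x) (sg x))"
    using scaled_lpf_flow[OF assms] by (simp add: vec_eq_iff lin_state_def)
  have "ell x $ j = ell (lin_state c (sc x) (sg x)) $ j" for j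
  proof -
    obtain i where ij: "(i, Some j) \<in> lines G"
      using parent_ex by blast
    then have "ell x $ j = (cmod (flow x $ j))\<^sup>2 / volt G x i"
      using assms unfolding scaled_lpf_def by blast
    then show ?thesis
      by (simp add: lin_state_def parent_eq[OF ij] scaled_lpf_flow[OF assms]
          scaled_lpf_volt[OF assms])
  qed
  then show "ell x = ell (lin_state c (sc x) (sg x))"
    by (simp add: vec_eq_iff)
qed (simp_all add: lin_state_def)

text \<open>Existence and uniqueness in the form of an equation, so that the \<open>THE\<close> in
  both state functions evaluates to \<open>lin_state\<close>.\<close>

lemma scaled_lpf_iff:
  "scaled_lpf c G x \<and> sc x = s \<and> sg x = g \<longleftrightarrow> x = lin_state c s g"
  using scaled_lpf_unique[of c x] scaled_lpf_lin_state[of c s g] by (auto simp: lin_state_def)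

lemma lpf_state_eq: "lpf_state G \<psi> \<phi> = lin_state 1 (consumption G \<phi>) (generation \<psi> \<phi>)"
  by (simp add: lpf_state_def lpf_eq_scaled scaled_lpf_iff)

lemma elpf_state_eq:
  "elpf_state G \<psi> \<phi> = lin_state (1 + eps G) (consumption G \<phi>) (generation \<psi> \<phi>)"
  by (simp add: elpf_state_def elpf_eq_scaled scaled_lpf_iff)

text \<open>After interchanging the sum over lines on the path to \<open>k\<close> with the sum over
  nodes fed by each line, the demand of \<open>m\<close> meets exactly the lines shared by both
  paths, whose impedances add up to \<open>Zpath G k m\<close>.\<close>

lemma nu_lin_state:
  "nu (lin_state c s g) $ k
     = nu_sub G - 2 * c * (\<Sum>m\<in>UNIV. Re (cnj (Zpath G k m) * (s $ m - g $ m)))"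
proof -
  define d where "d = s - g"
  have "(\<Sum>j\<in>path_nodes G k. cnj (imped G $ j) * lin_flow c d $ j)
      = (\<Sum>j\<in>path_nodes G k. \<Sum>m\<in>UNIV.
          if j \<in> path_nodes G m then c *\<^sub>R (cnj (imped G $ j) * d $ m) else 0)"
    by (simp add: lin_flow_def subtree_def sum_distrib_left sum.If_cases)
  also have "\<dots> = (\<Sum>m\<in>UNIV. \<Sum>j\<in>path_nodes G k.
          if j \<in> path_nodes G m then c *\<^sub>R (cnj (imped G $ j) * d $ m) else 0)"
    by (rule sum.swap)
  also have "\<dots> = (\<Sum>m\<in>UNIV. c *\<^sub>R (cnj (Zpath G k m) * d $ m))"
    by (intro sum.cong refl)
      (simp add: Zpath_def sum_distrib_right scaleR_sum_right
        flip: sum.inter_restrict)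
  finally have "Re (\<Sum>j\<in>path_nodes G k. cnj (imped G $ j) * lin_flow c d $ j)
      = Re (c *\<^sub>R (\<Sum>m\<in>UNIV. cnj (Zpath G k m) * d $ m))"
    by (simp only: scaleR_sum_right)
  then have "(\<Sum>j\<in>path_nodes G k. Re (cnj (imped G $ j) * lin_flow c d $ j))
      = c * (\<Sum>m\<in>UNIV. Re (cnj (Zpath G k m) * d $ m))"
    by (simp only: Re_sum scaleR_complex.sel)
  then show ?thesis
    by (simp add: lin_state_def lin_nu_def d_def del: times_complex.sel)
qed

end

section \<open>Angles: \<open>arccot\<close>, \<open>Arg\<close> and projection onto a
  sector\<close>

lemma arccot_eq: "arccot t = pi / 2 - arctan t"
  unfolding arccot_def
proof (rule the_equality)
  have "-(pi/2) < arctan t" "arctan t < pi/2"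
    using arctan_bounded[of t] by auto
  moreover have "cot (pi / 2 - arctan t) = t"
    using tan_cot[of "arctan t"] by (simp add: cot_altdef tan_arctan)
  ultimately show "0 < pi / 2 - arctan t \<and> pi / 2 - arctan t < pi \<and> cot (pi / 2 - arctan t) = t"
    by auto
next
  fix \<theta> :: real assume \<theta>: "0 < \<theta> \<and> \<theta> < pi \<and> cot \<theta> = t"
  then have "tan (pi / 2 - \<theta>) = t"
    using tan_cot[of \<theta>] by (simp add: cot_altdef)
  then have "arctan t = pi / 2 - \<theta>"
    using \<theta> by (intro arctan_unique) auto
  then show "\<theta> = pi / 2 - arctan t" by simp
qed

lemma arccot_antimono: "s \<le> t \<Longrightarrow> arccot t \<le> arccot s"
  by (simp add: arccot_eq arctan_le_iff)

lemma arccot_pos_bounds: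
  assumes "0 < t"
  shows "0 < arccot t" "arccot t < pi / 2"
  using assms arctan_ubound[of t] by (simp_all add: arccot_eq)

lemma Arg_eq_arccot:
  assumes "0 < Re z" "0 < Im z"
  shows "Arg z = arccot (Re z / Im z)"
proof -
  have "z \<noteq> 0" using assms by auto
  have "\<bar>Arg z\<bar> < pi / 2" "0 < Arg z"
    using assms Arg_Re_pos[of z] Arg_pos_iff[of z] by auto
  moreover have "tan (Arg z) = Im z / Re z"
    using \<open>z \<noteq> 0\<close> by (simp add: tan_def sin_Arg cos_Arg)
  then have "tan (pi / 2 - Arg z) = Re z / Im z"
    using tan_cot[of "Arg z"] by simp
  ultimately have "arctan (Re z / Im z) = pi / 2 - Arg z"
    by (intro arctan_unique) auto
  then show ?thesis by (simp add: arccot_eq)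
qed

text \<open>The modulus is replaced by \<open>r\<close>, so \<open>0\<close> too is sent to full
  modulus: its \<open>Arg\<close> is \<open>0\<close>, which for \<open>0 < a\<close> and
  \<open>a \<le> b\<close> is clamped to \<open>a\<close>.\<close>

definition sector_proj :: "real \<Rightarrow> real \<Rightarrow> real \<Rightarrow> complex \<Rightarrow> complex" where
  "sector_proj a b r p = rcis r (max a (min b (Arg p)))"

text \<open>The plane inner product of \<open>z\<close> and \<open>p\<close>; its polar form
  separates the modulus of \<open>p\<close> from the angular distance to \<open>z\<close>.\<close>

lemma Re_cnj_mult_polar: "Re (cnj z * p) = cmod z * (cmod p * cos (Arg p - Arg z))"
proof -
  have "cnj z * p = rcis (cmod z) (- Arg z) * rcis (cmod p) (Arg p)"
    by (simp add: rcis_cmod_Arg rcis_cnj)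
  also have "\<dots> = rcis (cmod z * cmod p) (Arg p - Arg z)"
    by (simp add: rcis_mult)
  finally show ?thesis by simp
qed

context
  fixes a b r :: real
  assumes ab: "0 < a" "a \<le> b" "b < pi / 2" and r: "0 \<le> r"
begin

lemma sector_angle: "max a (min b t) \<in> {a..b}"
  using ab by auto

lemma cmod_sector_proj: "cmod (sector_proj a b r p) = r"
  using r by (simp add: sector_proj_def)

lemma Arg_sector_proj:
  assumes "r \<noteq> 0"
  shows "Arg (sector_proj a b r p) \<in> {a..b}"
proof -
  have "Arg (sector_proj a b r p) = max a (min b (Arg p))"
    unfolding sector_proj_def using sector_angle[of "Arg p"] ab r assms
    by (intro Arg_rcis) auto
  then show ?thesis using sector_angle by simp
qed

lemma Re_sector_proj_nonneg: "0 \<le> Re (sector_proj a b r p)"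
  using sector_angle[of "Arg p"] ab r
  by (auto simp: sector_proj_def intro!: mult_nonneg_nonneg cos_ge_zero)

text \<open>Clamping the argument to a sector that contains \<open>Arg z\<close> moves it closer to \<open>Arg z\<close>,
  and \<open>cos\<close> decreases on \<open>[0, pi]\<close>.\<close>

lemma Re_cnj_mult_le_sector_proj:
  assumes z: "Arg z \<in> {a..b}" and p: "0 \<le> Re p" "cmod p \<le> r"
  shows "Re (cnj z * p) \<le> Re (cnj z * sector_proj a b r p)"
    and "z \<noteq> 0 \<Longrightarrow> p \<noteq> sector_proj a b r p \<Longrightarrow>
      Re (cnj z * p) < Re (cnj z * sector_proj a b r p)"
proof -
  define t where "t = max a (min b (Arg p))"
  have t: "t \<in> {a..b}" unfolding t_def by (rule sector_angle)
  have argp: "\<bar>Arg p\<bar> \<le> pi / 2" using p Arg_Re_nonneg[of p] by simp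
  have "\<bar>t - Arg z\<bar> \<le> \<bar>Arg p - Arg z\<bar>"
    using z ab by (auto simp: t_def)
  moreover have "\<bar>Arg p - Arg z\<bar> \<le> pi"
    using z argp ab unfolding abs_le_iff atLeastAtMost_iff by linarith
  moreover have "\<bar>t - Arg z\<bar> < pi / 2"
    using z t ab unfolding abs_less_iff atLeastAtMost_iff by linarith
  ultimately have closer: "\<bar>t - Arg z\<bar> \<le> \<bar>Arg p - Arg z\<bar>" "\<bar>Arg p - Arg z\<bar> \<le> pi"
    "\<bar>t - Arg z\<bar> < pi / 2" .
  have cos_le: "cos (Arg p - Arg z) \<le> cos (t - Arg z)"
    using cos_monotone_0_pi_le[of "\<bar>t - Arg z\<bar>" "\<bar>Arg p - Arg z\<bar>"] closer by simp
  have cos_less: "cos (Arg p - Arg z) < cos (t - Arg z)" if "t \<noteq> Arg p"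
  proof -
    have "\<bar>t - Arg z\<bar> < \<bar>Arg p - Arg z\<bar>"
      using that z argp ab by (auto simp: t_def)
    then show ?thesis
      using cos_monotone_0_pi[of "\<bar>t - Arg z\<bar>" "\<bar>Arg p - Arg z\<bar>"] closer by simp
  qed
  \<comment> \<open>Two angles of the sector differ by less than a right angle, so a larger modulus
    is a strict gain there.\<close>
  have cos_pos: "0 < cos (t - Arg z)"
    using closer(3) unfolding abs_less_iff by (intro cos_gt_zero_pi) linarith+
  have proj: "Re (cnj z * sector_proj a b r p) = cmod z * (r * cos (t - Arg z))"
  \<comment> \<open>For \<open>r = 0\<close> the projection is \<open>0\<close>, whose
    \<open>Arg\<close> need not be \<open>t\<close>, but both sides vanish.\<close>
  proof (cases "r = 0")
    case False
    have "Arg (sector_proj a b r p) = t"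
      unfolding sector_proj_def t_def[symmetric] using t ab r False
      by (intro Arg_rcis) auto
    then show ?thesis
      by (simp add: Re_cnj_mult_polar cmod_sector_proj del: times_complex.sel)
  qed (simp add: sector_proj_def)
  have le1: "cmod p * cos (Arg p - Arg z) \<le> cmod p * cos (t - Arg z)"
    using cos_le by (simp add: mult_left_mono)
  have le2: "cmod p * cos (t - Arg z) \<le> r * cos (t - Arg z)"
    using p cos_pos by simp
  show "Re (cnj z * p) \<le> Re (cnj z * sector_proj a b r p)"
    unfolding proj Re_cnj_mult_polar[of z p] using le1 le2 by (intro mult_left_mono) auto
  assume "z \<noteq> 0" and ne: "p \<noteq> sector_proj a b r p"
  \<comment> \<open>Rotation gains nothing at \<open>p = 0\<close>, hence the extra condition. If
    \<open>0\<close> has full modulus, then \<open>r = 0\<close> and \<open>p\<close> is its own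
    projection.\<close>
  have "cmod p < r \<or> (t \<noteq> Arg p \<and> 0 < cmod p)"
  proof (rule ccontr)
    assume "\<not> ?thesis"
    then have "cmod p = r" "t = Arg p \<or> p = 0" using p by auto
    then have "p = rcis r t" using rcis_cmod_Arg[of p] by auto
    then show False using ne by (simp add: sector_proj_def t_def)
  qed
  then have "cmod p * cos (Arg p - Arg z) < r * cos (t - Arg z)"
  proof
    assume "cmod p < r"
    then have "cmod p * cos (t - Arg z) < r * cos (t - Arg z)" using cos_pos by simp
    with le1 show ?thesis by simp
  next
    assume "t \<noteq> Arg p \<and> 0 < cmod p"
    then have "cmod p * cos (Arg p - Arg z) < cmod p * cos (t - Arg z)"
      using cos_less by (intro mult_strict_left_mono) auto
    with le2 show ?thesis by simp
  qed
  then show "Re (cnj z * p) < Re (cnj z * sector_proj a b r p)"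
    unfolding proj Re_cnj_mult_polar[of z p] using \<open>z \<noteq> 0\<close> by (intro mult_strict_left_mono) auto
qed

end

text \<open>The bounds \<open>k1 * Im \<le> Re\<close> and \<open>Re \<le> k2 * Im\<close> are
  linear and survive summation (the mediant inequality). As \<open>arccot\<close> decreases, the
  larger ratio gives the smaller angle.\<close>

lemma Arg_sum_impedances:
  fixes z :: "'i \<Rightarrow> complex"
  assumes "finite A" "A \<noteq> {}" and z: "\<And>k. k \<in> A \<Longrightarrow> 0 < Re (z k) \<and> 0 < Im (z k)"
    and K: "\<And>k. k \<in> A \<Longrightarrow> k1 \<le> Re (z k) / Im (z k) \<and> Re (z k) / Im (z k) \<le> k2"
  shows "sum z A \<noteq> 0" "Arg (sum z A) \<in> {arccot k2..arccot k1}"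
proof -
  have pos: "0 < Re (sum z A)" "0 < Im (sum z A)"
    using assms by (auto simp: intro!: sum_pos)
  then show "sum z A \<noteq> 0" by (metis less_irrefl zero_complex.sel(1))
  have "k1 * Im (sum z A) \<le> Re (sum z A)"
    using z K by (auto simp: sum_distrib_left field_simps intro!: sum_mono)
  moreover have "Re (sum z A) \<le> k2 * Im (sum z A)"
    using z K by (auto simp: sum_distrib_left field_simps intro!: sum_mono)
  ultimately have "k1 \<le> Re (sum z A) / Im (sum z A)" "Re (sum z A) / Im (sum z A) \<le> k2"
    using pos by (simp_all add: field_simps)
  then show "Arg (sum z A) \<in> {arccot k2..arccot k1}"
    using pos by (simp add: Arg_eq_arccot arccot_antimono del: Re_sum Im_sum)
qed

section \<open>Monotonicity of the voltage loss\<close>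

lemma infnorm_attained: "\<exists>k. infnorm v = \<bar>v $ k\<bar>" for v :: "real ^ 'n"
proof -
  have "Sup (range (\<lambda>k. \<bar>v $ k\<bar>)) \<in> range (\<lambda>k. \<bar>v $ k\<bar>)"
    by (subst cSup_eq_Max) (auto intro!: Max_in)
  then show ?thesis
    by (auto simp: infnorm_cart full_SetCompr_eq)
qed

context
  fixes G :: "('n::finite) network" and x y :: "'n state"
  assumes w: "\<And>k. 0 \<le> wVR G $ k" and le: "\<And>k. nu x $ k \<le> nu y $ k"
begin

lemma weighted_violation_mono: "weighted_violation G y $ k \<le> weighted_violation G x $ k"
  using w[of k] le[of k] by (auto simp: weighted_violation_def intro!: mult_left_mono)

lemma loss_VR_attained:
  obtains k where "loss_VR G y = weighted_violation G y $ k"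
proof -
  obtain k where "loss_VR G y = \<bar>weighted_violation G y $ k\<bar>"
    using infnorm_attained unfolding loss_VR_def by blast
  with w[of k] show ?thesis
    by (intro that[of k]) (simp add: weighted_violation_def)
qed

lemma weighted_violation_le_loss: "weighted_violation G x $ k \<le> loss_VR G x"
  unfolding loss_VR_def using component_le_infnorm_cart[of "weighted_violation G x" k] by linarith

lemma loss_VR_mono: "loss_VR G y \<le> loss_VR G x"
  using loss_VR_attained weighted_violation_mono weighted_violation_le_loss by (metis order_trans)

text \<open>Take a node of worst violation under \<open>y\<close>. If it is also worst under
  \<open>x\<close>, its voltage rises strictly; otherwise its violation under \<open>x\<close>
  already lies below the loss of \<open>x\<close>.\<close>

lemma loss_VR_strict_mono:
  assumes "0 < loss_VR G x"
    and "\<And>k. weighted_violation G x $ k = loss_VR G x \<Longrightarrow> nu x $ k < nu y $ k"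
  shows "loss_VR G y < loss_VR G x"
proof -
  obtain k where k: "loss_VR G y = weighted_violation G y $ k"
    by (rule loss_VR_attained)
  show ?thesis
  proof (cases "weighted_violation G x $ k = loss_VR G x")
    case True
    \<comment> \<open>Both factors must be positive, since otherwise a higher voltage would not
      lower the product.\<close>
    then have "0 < wVR G $ k * max (nu_lo G $ k - nu x $ k) 0"
      using assms(1) by (simp add: weighted_violation_def)
    then have "0 < wVR G $ k" "0 < max (nu_lo G $ k - nu x $ k) 0"
      using w[of k] by (auto simp: zero_less_mult_iff)
    moreover have "max (nu_lo G $ k - nu y $ k) 0 < max (nu_lo G $ k - nu x $ k) 0"
      using assms(2)[OF True] \<open>0 < max _ 0\<close> by auto
    ultimately have "weighted_violation G y $ k < weighted_violation G x $ k"
      by (simp add: weighted_violation_def)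
    then show ?thesis using k True by simp
  next
    case False
    then have "weighted_violation G x $ k < loss_VR G x"
      using weighted_violation_le_loss[of k] by simp
    then show ?thesis using k weighted_violation_mono[of k] by simp
  qed
qed

end

section \<open>Compactness of the set-points and admissibility of the resulting states\<close>

lemma compact_setpoints: "compact (setpoints G)"
proof -
  have "closed (setpoints G)"
    unfolding setpoints_def
    by (intro closed_Collect_all closed_Collect_conj closed_Collect_le continuous_intros)
  moreover have "norm sp \<le> (\<Sum>i\<in>UNIV. sp_cap G $ i)" if "sp \<in> setpoints G" for sp
  proof -
    have "norm sp \<le> (\<Sum>i\<in>UNIV. cmod (sp $ i))"
      unfolding norm_vec_def by (intro L2_set_le_sum) simp
    also have "\<dots> \<le> (\<Sum>i\<in>UNIV. sp_cap G $ i)"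
      using that by (intro sum_mono) (simp add: setpoints_def)
    finally show ?thesis .
  qed
  then have "bounded (setpoints G)"
    by (auto intro: boundedI)
  ultimately show ?thesis by (simp add: compact_eq_bounded_closed)
qed

text \<open>Safety gives only the hard bounds and the absence of reverse flow. The signs of
  \<open>nu\<close> and \<open>ell\<close> follow from \<open>0 \<le> mu_lo G\<close> and from
  \<open>ell\<close> being a square over a voltage; the generation serves as its own set-point
  bound.\<close>

lemma admissible_if_safe:
  assumes "scaled_lpf c G x" "hard_bounds G x" "no_reverse_flow x"
    and "rooted_tree None (lines G)" "0 \<le> mu_lo G" "0 \<le> nu_sub G"
    and "\<And>i. cle (sc x $ i) (sc_nom G $ i)" "sg x \<in> setpoints G"
  shows "admissible G x"
proof -
  have nu: "0 \<le> nu x $ i" for i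
    using assms(2,5) unfolding hard_bounds_def by (meson order_trans)
  then have volt: "0 \<le> volt G x a" for a
    using assms(6) by (simp add: volt_def split: option.split)
  have ell: "0 \<le> ell x $ j" for j
  proof -
    obtain i where "(i, Some j) \<in> lines G"
      using assms(4) unfolding rooted_tree_def by blast
    then have "ell x $ j = (cmod (flow x $ j))\<^sup>2 / volt G x i"
      using assms(1) unfolding scaled_lpf_def by blast
    then show ?thesis using volt by simp
  qed
  have "\<exists>sp\<in>setpoints G. \<forall>i. cle (sg x $ i) (sp $ i)"
    using assms(8) by (intro bexI[of _ "sg x"]) (auto simp: cle_def)
  then show ?thesis
    using assms nu ell by (simp add: admissible_def)
qed

lemma generation_in_setpoints:
  assumes "(sp_a, \<delta>) \<in> attacks G M" "sp \<in> setpoints G"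
  shows "generation (sp_a, \<delta>) (sp, \<gamma>) \<in> setpoints G"
proof -
  have "generation (sp_a, \<delta>) (sp, \<gamma>) $ i = sp_a $ i \<or>
        generation (sp_a, \<delta>) (sp, \<gamma>) $ i = sp $ i" for i
  proof -
    have "\<delta> $ i = 0 \<or> \<delta> $ i = 1"
      using assms(1) by (auto simp: attacks_def)
    then show ?thesis by (auto simp: generation_def)
  qed
  then show ?thesis
    using assms unfolding attacks_def setpoints_def mem_Times_iff mem_Collect_eq fst_conv
    by metis
qed

text \<open>An integer power of the positive number \<open>1 - eps0 G\<close>. Hence the scaling in
  the second model keeps the sign of voltage changes.\<close>

lemma one_plus_eps_pos:
  assumes "0 < eps0 G" "eps0 G < 1"
  shows "0 < 1 + eps G"
  using assms by (simp add: eps_def)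

lemma K_bounds: "K_min G \<le> ratio G j" "ratio G j \<le> K_max G"
  by (simp_all add: K_min_def K_max_def)

lemma K_min_pos:
  assumes "network_data G"
  shows "0 < K_min G"
  using assms by (simp add: K_min_def ratio_def network_data_def)

section \<open>Redirecting set-points: effect on voltages and loss\<close>

context radial_network
begin

context
  fixes c :: real and sp_a :: "complex ^ 'n" and \<delta> \<gamma> :: "real ^ 'n"
  assumes data: "network_data G" and c: "0 < c" and \<delta>: "\<And>i. \<delta> $ i \<in> {0, 1}"
begin

abbreviation outcome :: "complex ^ 'n \<Rightarrow> 'n state" where
  "outcome sp \<equiv> lin_state c (consumption G (sp, \<gamma>)) (generation (sp_a, \<delta>) (sp, \<gamma>))"

text \<open>With different ratios the ideal angle for the voltage at \<open>k\<close> may vary with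
  \<open>k\<close>. The projection depends on the current set-point and is no worse than it for
  every \<open>k\<close> at once.\<close>

abbreviation best_response :: "'n \<Rightarrow> complex \<Rightarrow> complex" where
  "best_response i \<equiv> sector_proj (arccot (K_max G)) (arccot (K_min G)) (sp_cap G $ i)"

text \<open>Used with \<open>I = UNIV\<close> to build an optimum of the required form, and with
  \<open>I = {i}\<close> to refute optimality through one node.\<close>

definition redirect :: "'n set \<Rightarrow> complex ^ 'n \<Rightarrow> complex ^ 'n" where
  "redirect I sp = (\<chi> i. if i \<in> I then best_response i (sp $ i) else sp $ i)"

lemma sector_bounds:
  "0 < arccot (K_max G)" "arccot (K_max G) \<le> arccot (K_min G)" "arccot (K_min G) < pi / 2"
proof -
  have "K_min G \<le> K_max G"
    using K_bounds[of G] by (meson order_trans)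
  then show "0 < arccot (K_max G)" "arccot (K_max G) \<le> arccot (K_min G)"
    "arccot (K_min G) < pi / 2"
    using arccot_pos_bounds[of "K_min G"] arccot_pos_bounds[of "K_max G"] arccot_antimono
      K_min_pos[OF data] by auto
qed

lemma cap_nonneg: "0 \<le> sp_cap G $ i"
  using data by (simp add: network_data_def)

lemma Zpath_sector:
  assumes "path_nodes G k \<inter> path_nodes G i \<noteq> {}"
  shows "Zpath G k i \<noteq> 0" "Arg (Zpath G k i) \<in> {arccot (K_max G)..arccot (K_min G)}"
  using Arg_sum_impedances[of "path_nodes G k \<inter> path_nodes G i" "\<lambda>k. imped G $ k" "K_min G" "K_max G"]
    assms data K_bounds[of G]
  by (auto simp: Zpath_def network_data_def ratio_def)

lemma Re_cnj_Zpath_mult_le: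
  assumes "sp \<in> setpoints G"
  shows "Re (cnj (Zpath G k i) * sp $ i) \<le> Re (cnj (Zpath G k i) * best_response i (sp $ i))"
proof (cases "path_nodes G k \<inter> path_nodes G i = {}")
  case True
  then show ?thesis by (simp add: Zpath_def)
next
  case False
  with assms show ?thesis
    by (intro Re_cnj_mult_le_sector_proj sector_bounds cap_nonneg Zpath_sector)
      (auto simp: setpoints_def)
qed

lemma Re_cnj_Zpath_mult_less:
  assumes "sp \<in> setpoints G" "path_nodes G k \<inter> path_nodes G i \<noteq> {}"
    and "sp $ i \<noteq> best_response i (sp $ i)"
  shows "Re (cnj (Zpath G k i) * sp $ i) < Re (cnj (Zpath G k i) * best_response i (sp $ i))"
  using assms
  by (intro Re_cnj_mult_le_sector_proj sector_bounds cap_nonneg Zpath_sector)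
    (auto simp: setpoints_def)

lemma nu_outcome:
  "nu (outcome sp) $ k = nu_sub G - 2 * c * (\<Sum>m\<in>UNIV. Re (cnj (Zpath G k m) *
     (\<gamma> $ m *\<^sub>R sc_nom G $ m - \<delta> $ m *\<^sub>R sp_a $ m - (1 - \<delta> $ m) *\<^sub>R sp $ m)))"
  by (simp add: nu_lin_state consumption_def generation_def diff_diff_eq)

text \<open>Demand and attack cancel in the difference, and attacked nodes carry the factor
  \<open>0\<close>.\<close>

lemma nu_outcome_diff:
  "nu (outcome q) $ k - nu (outcome p) $ k = 2 * c *
     (\<Sum>m\<in>UNIV. (1 - \<delta> $ m) * (Re (cnj (Zpath G k m) * q $ m) - Re (cnj (Zpath G k m) * p $ m)))"
proof -
  have "(\<Sum>m\<in>UNIV. (1 - \<delta> $ m) * (Re (cnj (Zpath G k m) * q $ m) - Re (cnj (Zpath G k m) * p $ m)))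
    = (\<Sum>m\<in>UNIV. Re (cnj (Zpath G k m) *
         (\<gamma> $ m *\<^sub>R sc_nom G $ m - \<delta> $ m *\<^sub>R sp_a $ m - (1 - \<delta> $ m) *\<^sub>R p $ m)))
    - (\<Sum>m\<in>UNIV. Re (cnj (Zpath G k m) *
         (\<gamma> $ m *\<^sub>R sc_nom G $ m - \<delta> $ m *\<^sub>R sp_a $ m - (1 - \<delta> $ m) *\<^sub>R q $ m)))"
    unfolding sum_subtractf[symmetric] by (intro sum.cong) (simp_all add: algebra_simps)
  then show ?thesis
    by (simp only: nu_outcome) (simp add: right_diff_distrib)
qed

lemma nu_redirect_mono:
  assumes "sp \<in> setpoints G"
  shows "nu (outcome sp) $ k \<le> nu (outcome (redirect I sp)) $ k"
proof -
  have "0 \<le> nu (outcome (redirect I sp)) $ k - nu (outcome sp) $ k"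
    unfolding nu_outcome_diff
  proof (intro mult_nonneg_nonneg sum_nonneg)
    fix m
    show "0 \<le> 1 - \<delta> $ m" using \<delta>[of m] by auto
    show "0 \<le> Re (cnj (Zpath G k m) * redirect I sp $ m) - Re (cnj (Zpath G k m) * sp $ m)"
      using Re_cnj_Zpath_mult_le[OF assms, of k m] by (simp add: redirect_def)
  qed (use c in auto)
  then show ?thesis by simp
qed

lemma nu_redirect_strict_mono:
  assumes "sp \<in> setpoints G" "\<delta> $ i = 0" "path_nodes G i \<inter> path_nodes G k \<noteq> {}"
    and "sp $ i \<noteq> best_response i (sp $ i)"
  shows "nu (outcome sp) $ k < nu (outcome (redirect {i} sp)) $ k"
proof -
  \<comment> \<open>Only node \<open>i\<close> is changed, so the sum collapses to one strictly
    positive term.\<close>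
  have "(\<Sum>m\<in>UNIV. (1 - \<delta> $ m) *
        (Re (cnj (Zpath G k m) * redirect {i} sp $ m) - Re (cnj (Zpath G k m) * sp $ m)))
      = (\<Sum>m\<in>{i}. (1 - \<delta> $ m) *
        (Re (cnj (Zpath G k m) * redirect {i} sp $ m) - Re (cnj (Zpath G k m) * sp $ m)))"
    by (intro sum.mono_neutral_right) (auto simp: redirect_def)
  also have "0 < \<dots>"
    using Re_cnj_Zpath_mult_less[of sp k i] assms by (simp add: redirect_def Int_commute)
  finally have "0 < nu (outcome (redirect {i} sp)) $ k - nu (outcome sp) $ k"
    unfolding nu_outcome_diff using c by simp
  then show ?thesis by simp
qed

lemma redirect_in_setpoints:
  assumes "sp \<in> setpoints G"
  shows "redirect I sp \<in> setpoints G"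
  using assms
  by (simp add: setpoints_def redirect_def cmod_sector_proj[OF sector_bounds cap_nonneg]
      Re_sector_proj_nonneg[OF sector_bounds cap_nonneg])

lemma full_output_best_response:
  assumes "sp $ i = best_response i p"
  shows "full_output_at G sp i {arccot (K_max G)..arccot (K_min G)}"
  using cmod_sector_proj[OF sector_bounds cap_nonneg] Arg_sector_proj[OF sector_bounds cap_nonneg]
  unfolding full_output_at_def assms by blast

lemma wVR_nonneg: "0 \<le> wVR G $ k"
  using data by (simp add: network_data_def)

lemma continuous_on_loss_VR_outcome: "continuous_on S (\<lambda>sp. loss_VR G (outcome sp))"
  unfolding loss_VR_def weighted_violation_def nu_outcome
  by (intro continuous_intros continuous_on_vec_lambda)

text \<open>A minimizer exists by compactness and continuity, and redirecting all its nodes does not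
  increase the loss.\<close>

lemma optimal_full_output_exists:
  "\<exists>sp\<in>setpoints G. (\<forall>q\<in>setpoints G. loss_VR G (outcome sp) \<le> loss_VR G (outcome q)) \<and>
     (\<forall>i. \<delta> $ i = 0 \<longrightarrow> full_output_at G sp i {arccot (K_max G)..arccot (K_min G)})"
proof -
  have "0 \<in> setpoints G"
    using cap_nonneg by (simp add: setpoints_def)
  then obtain sp where sp: "sp \<in> setpoints G"
    and opt: "\<And>q. q \<in> setpoints G \<Longrightarrow> loss_VR G (outcome sp) \<le> loss_VR G (outcome q)"
    using continuous_attains_inf[OF compact_setpoints _ continuous_on_loss_VR_outcome] by blast
  let ?sp = "redirect UNIV sp"
  have "loss_VR G (outcome ?sp) \<le> loss_VR G (outcome sp)"
    using loss_VR_mono[OF wVR_nonneg nu_redirect_mono[OF sp]] .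
  moreover have "full_output_at G ?sp i {arccot (K_max G)..arccot (K_min G)}" for i
    by (rule full_output_best_response[of _ _ "sp $ i"]) (simp add: redirect_def)
  ultimately show ?thesis
    using redirect_in_setpoints[OF sp] opt by (intro bexI[of _ ?sp]) (auto intro: order_trans)
qed

lemma optimal_imp_full_output:
  assumes sp: "sp \<in> setpoints G"
    and opt: "\<And>q. q \<in> setpoints G \<Longrightarrow> loss_VR G (outcome sp) \<le> loss_VR G (outcome q)"
    and i: "\<delta> $ i = 0" and affects: "affects_loss G (outcome sp) i"
  shows "full_output_at G sp i {arccot (K_max G)..arccot (K_min G)}"
proof (rule full_output_best_response, rule ccontr)
  assume ne: "sp $ i \<noteq> best_response i (sp $ i)"
  have "loss_VR G (outcome (redirect {i} sp)) < loss_VR G (outcome sp)"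
  proof (rule loss_VR_strict_mono[OF wVR_nonneg nu_redirect_mono[OF sp]])
    show "0 < loss_VR G (outcome sp)"
      using affects by (simp add: affects_loss_def)
    show "nu (outcome sp) $ k < nu (outcome (redirect {i} sp)) $ k"
      if "weighted_violation G (outcome sp) $ k = loss_VR G (outcome sp)" for k
      using that affects
      by (intro nu_redirect_strict_mono sp i ne) (simp add: affects_loss_def)
  qed
  with opt[OF redirect_in_setpoints[OF sp]] show False
    by (meson not_le)
qed

end

end

text \<open>Only the worst violation counts, so minimizers need not be unique. Hence some minimizer
  has the form at all unattacked nodes, while for every minimizer it is asserted at the nodes with
  \<open>affects_loss\<close>.\<close>

theorem proposition2:
  fixes G :: "('n::finite) network" and M :: nat
    and sp_a :: "complex ^ 'n" and \<delta> :: "real ^ 'n" and \<gamma> :: "real ^ 'n"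
    and X :: "'n state set" and st :: "'n strategy \<Rightarrow> 'n state"
  assumes "network_data G"
    and "M \<le> CARD('n)"
    and "standing_assumptions G M"
    and "(sp_a, \<delta>) \<in> attacks G M"
    and "\<gamma> \<in> load_controls G"
    and model: "(X = X_lpf G \<and> st = lpf_state G (sp_a, \<delta>)) \<or>
                (X = X_elpf G \<and> st = elpf_state G (sp_a, \<delta>))"
    and "feasible_setpoints G X st \<gamma> \<noteq> {}"
  shows "(\<exists>sp \<in> optimal_setpoints G X st \<gamma>. \<forall>i. \<delta> $ i = 0 \<longrightarrow>
            full_output_at G sp i {arccot (K_max G) .. arccot (K_min G)} \<and>
            (\<forall>K. (\<forall>j. ratio G j = K) \<longrightarrow> full_output_at G sp i {arccot K}))
       \<and> (\<forall>sp \<in> optimal_setpoints G X st \<gamma>. \<forall>i. \<delta> $ i = 0 \<and> affects_loss G (st (sp, \<gamma>)) i \<longrightarrow>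
            full_output_at G sp i {arccot (K_max G) .. arccot (K_min G)} \<and>
            (\<forall>K. (\<forall>j. ratio G j = K) \<longrightarrow> full_output_at G sp i {arccot K}))"
proof -
  have tree: "rooted_tree None (lines G)"
    using assms(1) by (simp add: network_data_def)
  interpret radial_network G
    by unfold_locales (rule tree)
  have safe: "safe_profiles G M" and nu_sub: "nu_sub G = 1" and eps0: "0 < eps0 G" "eps0 G < 1"
    using assms(3) by (auto simp: standing_assumptions_def small_impedance_def small_losses_def)
  have mu: "0 \<le> mu_lo G"
    using assms(1) by (simp add: network_data_def)
  have \<delta>: "\<And>i. \<delta> $ i \<in> {0, 1}"
    using assms(4) by (auto simp: attacks_def)
  have profile: "(sp, \<gamma>) \<in> defenses G" if "sp \<in> setpoints G" for sp
    using that assms(5) by (simp add: defenses_def)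
  \<comment> \<open>The constant is \<open>1\<close> or \<open>1 + eps G\<close>; after this step
    the two models are not distinguished.\<close>
  obtain c where c: "0 < c"
    and X: "X = {x. scaled_lpf c G x \<and> admissible G x}"
    and st: "\<And>\<phi>. st \<phi> = lin_state c (consumption G \<phi>) (generation (sp_a, \<delta>) \<phi>)"
    and st_safe: "\<And>sp. sp \<in> setpoints G \<Longrightarrow>
          hard_bounds G (st (sp, \<gamma>)) \<and> no_reverse_flow (st (sp, \<gamma>))"
    using model
  proof
    assume "X = X_lpf G \<and> st = lpf_state G (sp_a, \<delta>)"
    with safe assms(4) profile show thesis
      by (intro that[of 1])
        (auto simp: X_lpf_def lpf_eq_scaled lpf_state_eq[symmetric] safe_profiles_def)
  next
    assume "X = X_elpf G \<and> st = elpf_state G (sp_a, \<delta>)"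
    with safe assms(4) profile one_plus_eps_pos[OF eps0] show thesis
      by (intro that[of "1 + eps G"])
        (auto simp: X_elpf_def elpf_eq_scaled elpf_state_eq[symmetric] safe_profiles_def)
  qed
  have st_sc: "sc (st (sp, \<gamma>)) = consumption G (sp, \<gamma>)"
    and st_sg: "sg (st (sp, \<gamma>)) = generation (sp_a, \<delta>) (sp, \<gamma>)" for sp
    by (simp_all add: st lin_state_def)
  \<comment> \<open>The bound on consumption does not involve the set-points, so one feasible
    profile gives it for all. It is not automatic: for negative parts of a nominal demand,
    \<open>\<gamma> $ i \<le> 1\<close> points the wrong way.\<close>
  obtain sp0 where "st (sp0, \<gamma>) \<in> X"
    using assms(7) by (auto simp: feasible_setpoints_def)
  then have sc: "cle (sc (st (sp, \<gamma>)) $ i) (sc_nom G $ i)" for sp i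
    by (simp add: X admissible_def st_sc consumption_def)
  have "st (sp, \<gamma>) \<in> X" if "sp \<in> setpoints G" for sp
    using admissible_if_safe[of c G "st (sp, \<gamma>)"] scaled_lpf_lin_state st_safe[OF that] tree mu
      nu_sub sc generation_in_setpoints[OF assms(4) that] st_sg
    unfolding X by (simp add: st)
  then have feasible: "feasible_setpoints G X st \<gamma> = setpoints G"
    by (auto simp: feasible_setpoints_def)
  \<comment> \<open>The load-control loss depends on \<open>\<gamma>\<close> alone and cancels from
    the comparison.\<close>
  have optimal: "sp \<in> optimal_setpoints G X st \<gamma> \<longleftrightarrow> sp \<in> setpoints G \<and>
      (\<forall>q\<in>setpoints G. loss_VR G (st (sp, \<gamma>)) \<le> loss_VR G (st (q, \<gamma>)))" for sp
    unfolding optimal_setpoints_def is_arg_min_def feasible loss_def by (auto simp: not_less)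
  have uniform: "full_output_at G sp i {arccot K}"
    if "full_output_at G sp i {arccot (K_max G)..arccot (K_min G)}" "\<forall>j. ratio G j = K" for sp i K
  proof -
    have "K_min G = K" "K_max G = K"
      using that(2) by (simp_all add: K_min_def K_max_def)
    with that(1) show ?thesis by simp
  qed
  have "\<exists>sp\<in>optimal_setpoints G X st \<gamma>. \<forall>i. \<delta> $ i = 0 \<longrightarrow>
      full_output_at G sp i {arccot (K_max G)..arccot (K_min G)}"
    using optimal_full_output_exists[OF assms(1) c \<delta>, where \<gamma> = \<gamma> and sp_a = sp_a] unfolding optimal Bex_def st
    by blast
  moreover have "full_output_at G sp i {arccot (K_max G)..arccot (K_min G)}"
    if "sp \<in> optimal_setpoints G X st \<gamma>" "\<delta> $ i = 0" "affects_loss G (st (sp, \<gamma>)) i" for sp i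
    using that unfolding optimal st
    by (intro optimal_imp_full_output[OF assms(1) c \<delta>]) auto
  ultimately show ?thesis
    using uniform by blast
qed

end
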